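(* Let $G=(\{1,\dots,n\},E)$ be a finite simple graph. Let $\vartheta'(G)$ be the optimum value of $$\max\Big\{\sum_{i=1}^n y_{0i}:\ y_{00}=1,\ y_{ij}=0\ \forall\{i,j\}\in E,\ y_{ii}=y_{0i}\ \forall i\in\{1,\dots,n\},\ Y\succeq 0\Big\},$$ where $Y=(y_{ij})_{0\le i,j\le n}$ is a symmetric $(n+1)\times(n+1)$ real matrix. Then $\vartheta'(G)=\vartheta(G)$, the Lovász theta number of $G$.
   Context: The Lovász theta number $\vartheta(G)$ is defined as the optimum value of $$\min\big\{t:\ \overline z_{ii}=t-1\ \forall i\in\{1,\dots,n\},\ \ \overline z_{ij}=-1\ \forall\{i,j\}\notin E\ (i\ne j),\ \ \overline Z\succeq 0\big\},$$ over $t\in\mathbb{R}$ and real symmetric $\overline Z=(\overline z_{ij})\in\mathbb{R}^{n\times n}$. $M\succeq0$ means $M$ is symmetric positive semidefinite. *)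

theory Defs
  imports "HOL-Analysis.Analysis"
begin

definition simple_graph :: "'n::finite set set \<Rightarrow> bool"
  where "simple_graph E \<longleftrightarrow> (\<forall>e\<in>E. card e = 2)"

definition pos_semidef :: "real^'n^'n \<Rightarrow> bool"
  where "pos_semidef M \<longleftrightarrow> transpose M = M \<and> (\<forall>x. 0 \<le> x \<bullet> (M *v x))"

text \<open>The vertices are the elements of an arbitrary finite type, which stands for
  $1, \dots, n$ with $n \ge 1$; a graph on them is given by its edge set.\<close>

definition theta_feasible :: "'n::finite set set \<Rightarrow> real \<Rightarrow> real^'n^'n \<Rightarrow> bool"
  where "theta_feasible E t Z \<longleftrightarrow>
    (\<forall>i. Z $ i $ i = t - 1) \<and>
    (\<forall>i j. i \<noteq> j \<longrightarrow> {i, j} \<notin> E \<longrightarrow> Z $ i $ j = -1) \<and>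
    pos_semidef Z"

definition lovasz_theta :: "'n::finite set set \<Rightarrow> real"
  where "lovasz_theta E = Inf {t. \<exists>Z. theta_feasible E t Z}"

text \<open>Matrices of order $n + 1$ are indexed by the option type over the vertices:
  \<^term>\<open>None\<close> is the index $0$ and \<^term>\<open>Some i\<close> the index of the vertex $i$.\<close>

definition theta'_feasible :: "'n::finite set set \<Rightarrow> real^('n option)^('n option) \<Rightarrow> bool"
  where "theta'_feasible E Y \<longleftrightarrow>
    Y $ None $ None = 1 \<and>
    (\<forall>i j. {i, j} \<in> E \<longrightarrow> Y $ Some i $ Some j = 0) \<and>
    (\<forall>i. Y $ Some i $ Some i = Y $ None $ Some i) \<and>
    pos_semidef Y"

definition theta'_objective :: "real^('n::finite option)^('n option) \<Rightarrow> real"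
  where "theta'_objective Y = (\<Sum>i\<in>UNIV. Y $ None $ Some i)"

definition theta' :: "'n::finite set set \<Rightarrow> real"
  where "theta' E = Sup {theta'_objective Y |Y. theta'_feasible E Y}"

text \<open>On the reals, \<^const>\<open>Sup\<close> and \<^const>\<open>Inf\<close> of an empty or unbounded set are
  meaningless, and an optimum need not be attained.  The following predicates express that
  a number is the value of the maximum, respectively the minimum, of a set of reals.\<close>

definition is_maximum :: "real set \<Rightarrow> real \<Rightarrow> bool"
  where "is_maximum S m \<longleftrightarrow> m \<in> S \<and> (\<forall>s\<in>S. s \<le> m)"

definition is_minimum :: "real set \<Rightarrow> real \<Rightarrow> bool"
  where "is_minimum S m \<longleftrightarrow> m \<in> S \<and> (\<forall>s\<in>S. m \<le> s)"

end

theory Submission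
  imports Defs
begin

text \<open>Weak duality: if \<open>P\<close> is \<open>Y\<close> without its row and column \<open>0\<close> and \<open>s\<close> is the objective
  value, then \<open>\<langle>Z, P\<rangle> \<ge> 0\<close> bounds the sum of the entries of \<open>P\<close> by \<open>t s\<close>, while testing \<open>Y\<close> on
  \<open>(-s, 1, \<dots>, 1)\<close> bounds it from below by \<open>s\<^sup>2\<close>; hence \<open>s \<le> t\<close>.

  Strong duality: the maximum \<open>t\<close> is attained by compactness.  Separating the positive
  semidefinite cone from the matrices that satisfy the linear constraints with objective value
  above \<open>t\<close> gives a positive semidefinite \<open>S\<close> with \<open>S\<^sub>0\<^sub>0 \<le> t\<close>, \<open>S\<^sub>i\<^sub>i = 2 u\<^sub>i - 1\<close> for
  \<open>u\<^sub>i = - S\<^sub>0\<^sub>i\<close>, and zero entries at non-edges.  Dividing row and column \<open>i\<close> by \<open>u\<^sub>i > 0\<close> makes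
  the border \<open>-1\<close> and the diagonal at most \<open>1\<close>; raising the diagonal to \<open>1\<close> yields \<open>W\<close>, and
  the Schur complement of the corner shows that \<open>t W - J\<close>, with \<open>J\<close> the all-ones matrix, is
  positive semidefinite, so it is a feasible \<open>Z\<close>.\<close>

section \<open>Positive semidefinite matrices\<close>

lemma quadratic_form_eq_sum:
  fixes M :: "real^'n::finite^'n"
  shows "x \<bullet> (M *v x) = (\<Sum>i\<in>UNIV. \<Sum>j\<in>UNIV. M$i$j * x$i * x$j)"
  by (simp add: inner_vec_def matrix_vector_mult_def sum_distrib_left mult_ac)

lemma quadratic_form_eq_inner:
  fixes M :: "real^'n::finite^'n"
  shows "x \<bullet> (M *v x) = M \<bullet> (\<chi> i j. x$i * x$j)"
  unfolding quadratic_form_eq_sum by (simp add: inner_vec_def mult_ac)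

lemma pos_semidef_symmetric:
  assumes "pos_semidef M"
  shows "M$i$j = M$j$i"
  using assms unfolding pos_semidef_def transpose_def by (metis vec_lambda_beta)

lemma pos_semidefI:
  fixes M :: "real^'n::finite^'n"
  assumes "\<And>i j. M$i$j = M$j$i"
    and "\<And>x. 0 \<le> (\<Sum>i\<in>UNIV. \<Sum>j\<in>UNIV. M$i$j * x i * x j)"
  shows "pos_semidef M"
  unfolding pos_semidef_def quadratic_form_eq_sum
proof (intro conjI allI)
  show "transpose M = M"
    using assms(1) by (simp add: vec_eq_iff transpose_def)
qed (rule assms(2))

lemma pos_semidefD:
  fixes M :: "real^'n::finite^'n"
  assumes "pos_semidef M"
  shows "0 \<le> (\<Sum>i\<in>UNIV. \<Sum>j\<in>UNIV. M$i$j * x i * x j)"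
proof -
  have "0 \<le> (\<chi> i. x i) \<bullet> (M *v (\<chi> i. x i))"
    using assms unfolding pos_semidef_def by blast
  then show ?thesis unfolding quadratic_form_eq_sum by simp
qed

lemma quadratic_form_axis_add:
  fixes M :: "real^'n::finite^'n"
  shows "(a *\<^sub>R axis i 1 + b *\<^sub>R axis j 1) \<bullet> (M *v (a *\<^sub>R axis i 1 + b *\<^sub>R axis j 1))
     = a\<^sup>2 * M$i$i + a * b * (M$i$j + M$j$i) + b\<^sup>2 * M$j$j"
  by (simp add: matrix_vector_mult_basis inner_axis' column_def power2_eq_square algebra_simps)

lemma axis_nth_real:
  fixes c :: real
  shows "axis b c $ j = (if j = b then c else 0)"
    and "axis a (axis b c) $ i $ j = (if i = a \<and> j = b then c else 0)"
  by (simp_all add: axis_def)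

lemma form_diagonal_nonneg:
  fixes M :: "real^'n::finite^'n"
  assumes "\<And>x. 0 \<le> x \<bullet> (M *v x)"
  shows "0 \<le> M$i$i"
  using assms[of "1 *\<^sub>R axis i 1 + 0 *\<^sub>R axis i 1"] unfolding quadratic_form_axis_add by simp

lemma linear_nonneg_imp_zero:
  fixes a b :: real
  assumes "\<And>r. 0 \<le> a + r * b"
  shows "b = 0"
proof (rule ccontr)
  assume "b \<noteq> 0"
  then show False using assms[of "- (a + 1) / b"] by simp
qed

text \<open>Along the vectors \<open>r e_i + e_j\<close> the quadratic term in \<open>r\<close>
  drops out, and an affine function of \<open>r\<close> that stays nonnegative has slope
  zero.\<close>

lemma form_zero_diagonal_imp_zero_row:
  fixes M :: "real^'n::finite^'n"
  assumes psd: "\<And>x. 0 \<le> x \<bullet> (M *v x)" and "M$i$i = 0" and sym: "M$i$j = M$j$i"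
  shows "M$i$j = 0"
proof -
  have "0 \<le> M$j$j + r * (2 * M$i$j)" for r
    using psd[of "r *\<^sub>R axis i 1 + 1 *\<^sub>R axis j 1"] assms(2) sym
    unfolding quadratic_form_axis_add by simp
  from linear_nonneg_imp_zero[OF this] show ?thesis by simp
qed

text \<open>Eliminating one pivot writes a positive semidefinite matrix as a rank-one positive
  semidefinite matrix plus a Schur complement with smaller support.\<close>
lemma pos_semidef_Schur_complement:
  fixes M :: "real^'n::finite^'n"
  assumes M: "pos_semidef M" and pos: "0 < M$a$a"
  shows "pos_semidef (\<chi> i j. M$i$j - M$a$i * M$a$j / M$a$a)"
proof (rule pos_semidefI)
  note sym = pos_semidef_symmetric[OF M]
  show "(\<chi> i j. M$i$j - M$a$i * M$a$j / M$a$a) $ i $ j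
      = (\<chi> i j. M$i$j - M$a$i * M$a$j / M$a$a) $ j $ i" for i j
    using sym[of i j] by simp
  fix x :: "'n \<Rightarrow> real"
  define w where "w = (\<Sum>j\<in>UNIV. M$a$j * x j)"
  define v where "v = (\<chi> i. x i)"
  have w: "(M *v v) $ a = w"
    by (simp add: w_def v_def matrix_vector_mult_def)
  have w': "v \<bullet> column a M = w"
    by (simp add: w_def v_def inner_vec_def column_def sym[of _ a] mult.commute)
  \<comment> \<open>Subtracting this multiple of the basis vector at \<open>a\<close> minimizes the
    form of \<open>M\<close> over the coordinate \<open>a\<close>; the minimum is the form of the
    Schur complement at \<open>v\<close>.\<close>
  have "0 \<le> (v - (w / M$a$a) *\<^sub>R axis a 1) \<bullet> (M *v (v - (w / M$a$a) *\<^sub>R axis a 1))"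
    using M unfolding pos_semidef_def by blast
  also have "\<dots> = v \<bullet> (M *v v) - w * w / M$a$a"
    using pos w w'
    by (simp add: matrix_vector_mult_diff_distrib matrix_vector_mult_scaleR inner_diff_left
        inner_diff_right matrix_vector_mult_basis inner_axis' column_def field_simps)
  also have "\<dots> = (\<Sum>i\<in>UNIV. \<Sum>j\<in>UNIV. (\<chi> i j. M$i$j - M$a$i * M$a$j / M$a$a) $ i $ j * x i * x j)"
    unfolding quadratic_form_eq_sum v_def w_def sum_product
    by (simp add: sum_subtractf sum_divide_distrib algebra_simps)
  finally show "0 \<le> \<dots>" .
qed

text \<open>Induction on a set of indices outside which the rows of \<open>M\<close> vanish. Each
  nonzero pivot splits off a rank-one term built from row \<open>a\<close>, and its inner product
  with \<open>P\<close> is the form of \<open>P\<close> at that row divided by the positive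
  pivot.\<close>

lemma pos_semidef_inner_nonneg:
  fixes M P :: "real^'n::finite^'n"
  assumes M: "pos_semidef M" and P: "pos_semidef P"
  shows "0 \<le> (\<Sum>i\<in>UNIV. \<Sum>j\<in>UNIV. M$i$j * P$i$j)"
proof -
  have "0 \<le> (\<Sum>i\<in>UNIV. \<Sum>j\<in>UNIV. M$i$j * P$i$j)"
    if "finite A" "pos_semidef M" "\<And>i j. i \<notin> A \<Longrightarrow> M$i$j = 0" for A and M :: "real^'n^'n"
    using that
  proof (induction A arbitrary: M rule: finite_induct)
    case empty
    then show ?case by simp
  next
    case (insert a A)
    note sym = pos_semidef_symmetric[OF insert.prems(1)]
    have psd: "\<And>x. 0 \<le> x \<bullet> (M *v x)"
      using insert.prems(1) unfolding pos_semidef_def by blast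
    show ?case
    proof (cases "M$a$a = 0")
      case True
      then have "M$a$j = 0" for j
        using form_zero_diagonal_imp_zero_row[OF psd] sym by blast
      then have "\<And>i j. i \<notin> A \<Longrightarrow> M$i$j = 0"
        using insert.prems(2) by (metis insert_iff)
      then show ?thesis using insert.IH insert.prems(1) by blast
    next
      case False
      then have pos: "0 < M$a$a"
        using form_diagonal_nonneg[OF psd, of a] by simp
      define N :: "real^'n^'n" where "N = (\<chi> i j. M$i$j - M$a$i * M$a$j / M$a$a)"
      have "pos_semidef N"
        unfolding N_def by (rule pos_semidef_Schur_complement[OF insert.prems(1) pos])
      moreover have "N$i$j = 0" if "i \<notin> A" for i j
      proof (cases "i = a")
        case True
        then show ?thesis using pos by (simp add: N_def)
      next
        case False
        then have "M$i$k = 0" for k using that insert.prems(2) by blast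
        then show ?thesis using sym[of a i] by (simp add: N_def)
      qed
      ultimately have "0 \<le> (\<Sum>i\<in>UNIV. \<Sum>j\<in>UNIV. N$i$j * P$i$j)"
        by (rule insert.IH)
      moreover have "0 \<le> (\<Sum>i\<in>UNIV. \<Sum>j\<in>UNIV. P$i$j * M$a$i * M$a$j) / M$a$a"
        using pos pos_semidefD[OF P] by simp
      moreover have "(\<Sum>i\<in>UNIV. \<Sum>j\<in>UNIV. M$i$j * P$i$j) = (\<Sum>i\<in>UNIV. \<Sum>j\<in>UNIV. N$i$j * P$i$j)
          + (\<Sum>i\<in>UNIV. \<Sum>j\<in>UNIV. P$i$j * M$a$i * M$a$j) / M$a$a"
        unfolding N_def sum_divide_distrib sum.distrib[symmetric]
        using pos by (intro sum.cong refl) (simp add: field_simps)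
      ultimately show ?thesis by linarith
    qed
  qed
  from this[of UNIV M] M show ?thesis by simp
qed

section \<open>Bordered matrices\<close>

lemma sum_UNIV_option:
  fixes f :: "'n::finite option \<Rightarrow> real"
  shows "sum f UNIV = f None + (\<Sum>i\<in>UNIV. f (Some i))"
  unfolding UNIV_option_conv by (subst sum.insert) (auto simp: sum.reindex)

lemma quadratic_form_option:
  fixes M :: "real^('n::finite option)^('n option)"
  assumes "\<And>i. M $ Some i $ None = M $ None $ Some i"
  shows "(\<Sum>i\<in>UNIV. \<Sum>j\<in>UNIV. M$i$j * x i * x j) =
    M $ None $ None * (x None)\<^sup>2 + 2 * x None * (\<Sum>i\<in>UNIV. M $ None $ Some i * x (Some i))
    + (\<Sum>i\<in>UNIV. \<Sum>j\<in>UNIV. M $ Some i $ Some j * x (Some i) * x (Some j))"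
  unfolding sum_UNIV_option
  by (simp add: assms sum.distrib sum_distrib_left power2_eq_square mult_ac)

section \<open>Weak duality\<close>

lemma theta'_objective_le:
  fixes E :: "'n::finite set set"
  assumes Y: "theta'_feasible E Y" and Z: "theta_feasible E t Z"
  shows "theta'_objective Y \<le> t"
proof -
  define s where "s = theta'_objective Y"
  have psdY: "pos_semidef Y" and psdZ: "pos_semidef Z"
    and diag: "\<And>i. Z$i$i = t - 1"
    and Y00: "Y $ None $ None = 1"
    and Yii: "\<And>i. Y $ Some i $ Some i = Y $ None $ Some i"
    using Y Z unfolding theta'_feasible_def theta_feasible_def by auto
  note sym = pos_semidef_symmetric[OF psdY]
  note form = quadratic_form_option[where M = Y, OF sym]
  define P :: "real^'n^'n" where "P = (\<chi> i j. Y $ Some i $ Some j)"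
  define p where "p = (\<Sum>i\<in>UNIV. \<Sum>j\<in>UNIV. P$i$j)"
  have "pos_semidef P"
  proof (rule pos_semidefI)
    show "P$i$j = P$j$i" for i j using sym by (simp add: P_def)
    fix x :: "'n \<Rightarrow> real"
    show "0 \<le> (\<Sum>i\<in>UNIV. \<Sum>j\<in>UNIV. P$i$j * x i * x j)"
      using pos_semidefD[OF psdY, of "case_option 0 x"] unfolding form by (simp add: P_def)
  qed
  then have "0 \<le> (\<Sum>i\<in>UNIV. \<Sum>j\<in>UNIV. Z$i$j * P$i$j)"
    by (rule pos_semidef_inner_nonneg[OF psdZ])
  \<comment> \<open>For distinct indices, either \<open>Z\<close> has the entry \<open>-1\<close>
    (non-edge) or \<open>P\<close> has the entry \<open>0\<close> (edge), so the product is
    \<open>- P$i$j\<close> in both cases.\<close>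
  also have "\<dots> = (\<Sum>i\<in>UNIV. \<Sum>j\<in>UNIV. (if i = j then t * P$i$i else 0) - P$i$j)"
  proof (intro sum.cong refl)
    fix i j
    show "Z$i$j * P$i$j = (if i = j then t * P$i$i else 0) - P$i$j"
      using Y Z unfolding theta'_feasible_def theta_feasible_def P_def
      by (cases "i = j"; cases "{i,j} \<in> E") (auto simp: algebra_simps)
  qed
  also have "\<dots> = t * s - p"
    by (simp add: sum_subtractf p_def s_def theta'_objective_def P_def Yii sum_distrib_left)
  finally have "p \<le> t * s" by simp
  moreover have "0 \<le> p - s\<^sup>2"
    using pos_semidefD[OF psdY, of "case_option (- s) (\<lambda>_. 1)"] unfolding form
    by (simp add: Y00 p_def P_def s_def theta'_objective_def power2_eq_square)
  ultimately have "s * s \<le> t * s" by (simp add: power2_eq_square)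
  \<comment> \<open>Covers \<open>s \<le> 0\<close>, where \<open>s * s \<le> t * s\<close> does not
    by itself give \<open>s \<le> t\<close>.\<close>
  moreover have "0 \<le> t - 1"
    using form_diagonal_nonneg[of Z] psdZ diag unfolding pos_semidef_def by metis
  ultimately have "s \<le> t"
    by (cases "0 < s") auto
  then show ?thesis by (simp add: s_def)
qed

section \<open>The maximum is attained\<close>

text \<open>All entries lie in \<open>[-1, 1]\<close>: the form at \<open>e_0 - e_k\<close> equals
  \<open>1 - Y$k$k\<close> because \<open>Y$k$k = Y$None$k\<close>, and the forms at
  \<open>e_i + e_j\<close> and \<open>e_i - e_j\<close> then bound the off-diagonal entries.\<close>

lemma compact_theta'_feasible:
  fixes E :: "'n::finite set set"
  shows "compact {Y. theta'_feasible E Y}"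
proof (rule compact_eq_bounded_closed[THEN iffD2], rule conjI)
  have entry: "\<bar>Y$i$j\<bar> \<le> 1" if Y: "theta'_feasible E Y" for Y :: "real^('n option)^('n option)" and i j
  proof -
    have psd: "\<And>x. 0 \<le> x \<bullet> (Y *v x)" and psd': "pos_semidef Y"
      using Y unfolding theta'_feasible_def pos_semidef_def by auto
    note sym = pos_semidef_symmetric[OF psd']
    have diag: "Y$k$k \<le> 1" for k
    proof (cases k)
      case None
      then show ?thesis using Y unfolding theta'_feasible_def by simp
    next
      case (Some l)
      then show ?thesis
        using psd[of "1 *\<^sub>R axis None 1 + (-1) *\<^sub>R axis k 1"] Y sym[of None k]
        unfolding quadratic_form_axis_add theta'_feasible_def by simp
    qed
    show ?thesis
      using psd[of "1 *\<^sub>R axis i 1 + (-1) *\<^sub>R axis j 1"] psd[of "1 *\<^sub>R axis i 1 + 1 *\<^sub>R axis j 1"]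
        diag[of i] diag[of j] sym[of i j]
      unfolding quadratic_form_axis_add by simp
  qed
  show "bounded {Y. theta'_feasible E Y}"
    unfolding bounded_iff
  proof (intro exI ballI)
    fix Y assume "Y \<in> {Y. theta'_feasible E Y}"
    then have Y: "theta'_feasible E Y" by simp
    have "norm Y \<le> (\<Sum>i\<in>UNIV. norm (Y$i))" unfolding norm_vec_def by (rule L2_set_le_sum) simp
    also have "\<dots> \<le> (\<Sum>i\<in>UNIV. \<Sum>j\<in>UNIV. \<bar>Y$i$j\<bar>)" by (intro sum_mono norm_le_l1_cart)
    also have "\<dots> \<le> (\<Sum>i\<in>(UNIV :: 'n option set). \<Sum>j\<in>(UNIV :: 'n option set). 1)"
      by (intro sum_mono entry[OF Y])
    finally show "norm Y \<le> (\<Sum>i\<in>(UNIV :: 'n option set). \<Sum>j\<in>(UNIV :: 'n option set). 1)" .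
  qed
  show "closed {Y. theta'_feasible E Y}"
    unfolding theta'_feasible_def pos_semidef_def vec_eq_iff quadratic_form_eq_sum transpose_def
    by (intro closed_Collect_conj closed_Collect_all closed_Collect_imp open_Collect_const
        closed_Collect_eq closed_Collect_le) (auto intro!: continuous_intros)
qed

text \<open>A single vertex is a stable set; its indicator, extended by \<open>1\<close> at
  \<open>None\<close>, gives a rank-one solution. Besides nonemptiness this yields a positive
  optimum, by which the dual construction divides.\<close>

lemma theta'_feasible_vertex:
  fixes E :: "'n::finite set set"
  assumes "simple_graph E"
  shows "\<exists>Y. theta'_feasible E Y \<and> theta'_objective Y = 1"
proof -
  define a :: 'n where "a = undefined"
  define v where "v = (\<lambda>i. of_bool (i \<in> {None, Some a}) :: real)"
  define Y :: "real^('n option)^('n option)" where "Y = (\<chi> i j. v i * v j)"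
  have "pos_semidef Y"
  proof (rule pos_semidefI)
    fix x :: "'n option \<Rightarrow> real"
    have "(\<Sum>i\<in>UNIV. \<Sum>j\<in>UNIV. Y$i$j * x i * x j) = (\<Sum>i\<in>UNIV. v i * x i)\<^sup>2"
      unfolding power2_eq_square sum_product by (simp add: Y_def mult_ac)
    then show "0 \<le> (\<Sum>i\<in>UNIV. \<Sum>j\<in>UNIV. Y$i$j * x i * x j)" by simp
  qed (simp add: Y_def)
  \<comment> \<open>The edge constraint also ranges over \<open>i = j\<close>, where a loop would
    force the diagonal entry to vanish.\<close>
  moreover have "{a} \<notin> E" using assms unfolding simple_graph_def by fastforce
  ultimately have "theta'_feasible E Y"
    unfolding theta'_feasible_def by (auto simp: Y_def v_def)
  moreover have "theta'_objective Y = 1"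
    unfolding theta'_objective_def by (simp add: Y_def v_def)
  ultimately show ?thesis by blast
qed

lemma theta'_attained:
  fixes E :: "'n::finite set set"
  assumes "simple_graph E"
  obtains Y where "theta'_feasible E Y" "1 \<le> theta'_objective Y"
    "\<And>X. theta'_feasible E X \<Longrightarrow> theta'_objective X \<le> theta'_objective Y"
proof -
  obtain V where V: "theta'_feasible E V" "theta'_objective V = 1"
    using theta'_feasible_vertex[OF assms] by blast
  have "\<exists>Y\<in>{Y. theta'_feasible E Y}. \<forall>X\<in>{Y. theta'_feasible E Y}. theta'_objective X \<le> theta'_objective Y"
    using V unfolding theta'_objective_def
    by (intro continuous_attains_sup compact_theta'_feasible) (auto intro!: continuous_intros)
  with V that show ?thesis by fastforce
qed

section \<open>Strong duality\<close>

text \<open>Large \<open>s\<close> controls the slope, and \<open>s\<close> tending to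
  \<open>t\<close> from the right gives the value at the endpoint, which the hypothesis leaves
  out.\<close>

lemma affine_nonpos_on_ray:
  fixes a g t :: real
  assumes "\<And>s. t < s \<Longrightarrow> a + s * g \<le> 0"
  shows "g \<le> 0" "a + t * g \<le> 0"
proof -
  show "g \<le> 0"
  proof (rule ccontr)
    assume "\<not> g \<le> 0"
    then have g: "0 < g" by simp
    \<comment> \<open>The second argument makes \<open>a + s * g\<close> at least
      \<open>1\<close>.\<close>
    define s where "s = max (t + 1) ((1 - a) / g)"
    have "(1 - a) / g * g \<le> s * g" using g unfolding s_def by (intro mult_right_mono) auto
    moreover have "t < s" unfolding s_def by (simp add: less_max_iff_disj)
    ultimately show False using assms[of s] g by simp
  qed
  have "((\<lambda>s. a + s * g) \<longlongrightarrow> a + t * g) (at_right t)" by (intro tendsto_intros)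
  then show "a + t * g \<le> 0"
    by (rule tendsto_upperbound) (auto simp: assms intro: eventually_mono[OF eventually_at_right_less])
qed

text \<open>\<open>S\<close> is the normal of the separating hyperplane, rescaled. Whole lines
  contained in \<open>A\<close> turn into equations: entries at non-edges vanish, and
  \<open>S \<bullet> V i\<close> does not depend on \<open>i\<close>. The ray of objective values
  above \<open>t\<close> bounds the corner entry.\<close>

lemma theta'_separation:
  fixes E :: "'n::finite set set"
  assumes simple: "simple_graph E"
    and max: "\<And>X. theta'_feasible E X \<Longrightarrow> theta'_objective X \<le> t"
  obtains S :: "real^('n option)^('n option)" where "pos_semidef S" "S $ None $ None \<le> t"
    "\<And>i j. i \<noteq> j \<Longrightarrow> {i, j} \<notin> E \<Longrightarrow> S $ Some i $ Some j = 0"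
    "\<And>i. S $ Some i $ Some i + 2 * S $ None $ Some i = - 1"
proof -
  \<comment> \<open>Symmetry is not required in \<open>B\<close>: it contains all antisymmetric matrices, which forces the
    separating \<open>S\<close> to be symmetric.\<close>
  define B :: "(real^('n option)^('n option)) set" where "B = {Y. \<forall>x. 0 \<le> x \<bullet> (Y *v x)}"
  \<comment> \<open>Row and column \<open>None\<close> enter together, so the objective is counted
    twice and compared with \<open>2 * t\<close>.\<close>
  define A :: "(real^('n option)^('n option)) set" where "A = {Y. Y $ None $ None = 1 \<and>
    (\<forall>i j. {i, j} \<in> E \<longrightarrow> Y $ Some i $ Some j = 0) \<and>
    (\<forall>i. 2 * Y $ Some i $ Some i = Y $ None $ Some i + Y $ Some i $ None) \<and>
    2 * t < (\<Sum>i\<in>UNIV. Y $ None $ Some i + Y $ Some i $ None)}"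
  have loop: "{i} \<notin> E" for i using simple unfolding simple_graph_def by fastforce
  \<comment> \<open>\<open>V i\<close> raises \<open>Y$Some i$Some i\<close> and both border entries
    of \<open>i\<close> together, so \<open>O' + s *\<^sub>R V i\<close> satisfies the linear
    constraints with objective value \<open>s\<close>.\<close>
  define V :: "'n \<Rightarrow> real^('n option)^('n option)" where
    "V i = axis (Some i) (axis (Some i) 1) + axis None (axis (Some i) 1) + axis (Some i) (axis None 1)" for i
  define O' :: "real^('n option)^('n option)" where "O' = axis None (axis None 1)"
  have A_V: "O' + s *\<^sub>R V i + r *\<^sub>R (V i - V j) \<in> A" if "t < s" for s r i j
    using that unfolding A_def O'_def V_def
    by (auto simp: axis_nth_real loop sum.distrib sum_subtractf right_diff_distrib sum_distrib_left[symmetric])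
  have A_nonedge: "O' + (t + 1) *\<^sub>R V a + r *\<^sub>R axis (Some i) (axis (Some j) 1) \<in> A"
    if "i \<noteq> j" "{i, j} \<notin> E" for r i j a
    using that unfolding A_def O'_def V_def
    by (auto simp: axis_nth_real loop insert_commute sum.distrib sum_distrib_left[symmetric])
  have "convex B" unfolding convex_def B_def
    by (auto simp: matrix_vector_mult_add_rdistrib scaleR_matrix_vector_assoc[symmetric]
        inner_add_right)
  moreover have "convex A"
  proof -
    define f where "f Y = (\<Sum>i\<in>UNIV. Y $ None $ Some i + Y $ Some i $ None)"
      for Y :: "real^('n option)^('n option)"
    have "linear f"
      by (rule linearI) (simp_all add: f_def sum.distrib sum_distrib_left algebra_simps)
    then have "convex (f -` {2 * t<..})"
      by (rule convex_linear_vimage) (rule convex_real_interval)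
    moreover have "convex {Y :: real^('n option)^('n option). Y $ None $ None = 1 \<and>
        (\<forall>i j. {i, j} \<in> E \<longrightarrow> Y $ Some i $ Some j = 0) \<and>
        (\<forall>i. 2 * Y $ Some i $ Some i = Y $ None $ Some i + Y $ Some i $ None)}" (is "convex ?C")
      unfolding convex_def by (auto simp: distrib_left mult.left_commute[of 2])
    moreover have "A = ?C \<inter> f -` {2 * t<..}"
      unfolding A_def f_def by auto
    ultimately show ?thesis by (simp only: convex_Int)
  qed
  moreover have "0 \<in> B" unfolding B_def by simp
  moreover have "A \<noteq> {}" using A_V[where s = "t + 1" and r = 0] by auto
  moreover have "A \<inter> B = {}"
  proof (rule ccontr)
    assume "A \<inter> B \<noteq> {}"
    then obtain Y where A: "Y \<in> A" and B: "Y \<in> B" by blast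
    \<comment> \<open>The symmetric part has the same quadratic form, so it would be feasible with
      objective value above \<open>t\<close>.\<close>
    define X :: "real^('n option)^('n option)" where "X = (\<chi> i j. (Y$i$j + Y$j$i) / 2)"
    have "pos_semidef X"
    proof (rule pos_semidefI)
      fix x :: "'n option \<Rightarrow> real"
      have "0 \<le> (\<chi> i. x i) \<bullet> (Y *v (\<chi> i. x i))" using B unfolding B_def by blast
      also have "\<dots> = (\<Sum>i\<in>UNIV. \<Sum>j\<in>UNIV. Y$i$j * x i * x j)"
        unfolding quadratic_form_eq_sum by simp
      also have "\<dots> = ((\<Sum>i\<in>UNIV. \<Sum>j\<in>UNIV. Y$i$j * x i * x j) + (\<Sum>i\<in>UNIV. \<Sum>j\<in>UNIV. Y$j$i * x j * x i)) / 2"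
        by (subst (3) sum.swap) simp
      also have "\<dots> = (\<Sum>i\<in>UNIV. \<Sum>j\<in>UNIV. X$i$j * x i * x j)"
        unfolding sum.distrib[symmetric] sum_divide_distrib
        by (intro sum.cong refl) (simp add: X_def field_simps)
      finally show "0 \<le> \<dots>" .
    qed (simp add: X_def add.commute)
    then have "theta'_feasible E X"
      using A unfolding theta'_feasible_def A_def by (auto simp: X_def insert_commute)
    moreover have "t < theta'_objective X"
      using A unfolding theta'_objective_def A_def X_def by (simp add: sum_divide_distrib[symmetric])
    ultimately show False using max by fastforce
  qed
  ultimately obtain S b where "S \<noteq> 0" and Sb: "\<And>Y. Y \<in> A \<Longrightarrow> S \<bullet> Y \<le> b" "\<And>Y. Y \<in> B \<Longrightarrow> b \<le> S \<bullet> Y"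
    using separating_hyperplane_sets[of A B] by blast
  have "b \<le> 0" using Sb(2)[OF \<open>0 \<in> B\<close>] by simp
  have SA: "S \<bullet> Y \<le> 0" if "Y \<in> A" for Y using Sb(1)[OF that] \<open>b \<le> 0\<close> by simp
  have SB: "0 \<le> S \<bullet> Y" if "Y \<in> B" for Y
  proof (rule ccontr)
    assume neg: "\<not> 0 \<le> S \<bullet> Y"
    \<comment> \<open>\<open>B\<close> is a cone, and this multiple of \<open>Y\<close> has inner
      product \<open>b - 1\<close> with \<open>S\<close>, below the separating level
      \<open>b\<close>.\<close>
    define c where "c = (b - 1) / (S \<bullet> Y)"
    have "0 \<le> c" using neg \<open>b \<le> 0\<close> unfolding c_def by (simp add: divide_nonpos_neg)
    then have "c *\<^sub>R Y \<in> B"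
      using that unfolding B_def by (simp add: scaleR_matrix_vector_assoc[symmetric])
    from Sb(2)[OF this] show False using neg by (simp add: c_def)
  qed
  have [simp]: "S \<bullet> axis i (axis j 1) = S$i$j" for i j by (simp add: inner_axis)
  have sym: "S$i$j = S$j$i" for i j
  proof -
    have "0 \<le> S \<bullet> (axis k (axis l 1) - axis l (axis k 1))" for k l
      by (rule SB) (simp add: B_def quadratic_form_eq_inner inner_diff_left inner_axis')
    from this[of i j] this[of j i] show ?thesis by (simp add: inner_diff_right)
  qed
  have psd: "0 \<le> x \<bullet> (S *v x)" for x
  proof -
    have "0 \<le> S \<bullet> (\<chi> i j. x$i * x$j)"
    proof (rule SB, unfold B_def, safe)
      fix y :: "real^('n option)"
      have "y \<bullet> ((\<chi> i j. x$i * x$j) *v y) = (\<Sum>i\<in>UNIV. x$i * y$i)\<^sup>2"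
        unfolding power2_eq_square sum_product quadratic_form_eq_sum by (simp add: mult_ac)
      then show "0 \<le> y \<bullet> ((\<chi> i j. x$i * x$j) *v y)" by simp
    qed
    then show ?thesis unfolding quadratic_form_eq_inner .
  qed
  have nonedge: "S $ Some i $ Some j = 0" if "i \<noteq> j" "{i, j} \<notin> E" for i j
  proof -
    have "0 \<le> - (S \<bullet> (O' + (t + 1) *\<^sub>R V i)) + r * (- S $ Some i $ Some j)" for r
      using SA[OF A_nonedge[OF that, of i r]] by (simp add: inner_add_right)
    from linear_nonneg_imp_zero[OF this] show ?thesis by simp
  qed
  have same: "S \<bullet> V i = S \<bullet> V j" for i j
  proof -
    have "0 \<le> - (S \<bullet> (O' + (t + 1) *\<^sub>R V i)) + r * (- (S \<bullet> (V i - V j)))" for r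
      using SA[OF A_V[of "t + 1" i r j]] by (simp add: inner_add_right)
    from linear_nonneg_imp_zero[OF this] show ?thesis by (simp add: inner_diff_right)
  qed
  \<comment> \<open>By \<open>same\<close>, any vertex gives this value.\<close>
  define k where "k = - (S \<bullet> V undefined)"
  have SV: "S $ Some i $ Some i + 2 * S $ None $ Some i = - k" for i
    using same[of i undefined] sym[of "Some i" None] by (simp add: k_def V_def inner_add_right)
  have "S $ None $ None + s * (- k) \<le> 0" if "t < s" for s
    using SA[OF A_V[OF that, of undefined 0 undefined]] by (simp add: k_def inner_add_right O'_def)
  from affine_nonpos_on_ray[OF this] have "0 \<le> k" and S00: "S $ None $ None \<le> t * k" by simp_all
  \<comment> \<open>The hyperplane is not vertical, without any appeal to a Slater point: \<open>k = 0\<close> would make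
    the diagonal of \<open>S\<close> vanish.\<close>
  have "k \<noteq> 0"
  proof
    assume "k = 0"
    then have "S $ None $ None = 0" using S00 form_diagonal_nonneg[OF psd, of None] by simp
    then have row: "S $ None $ j = 0" for j
      using form_zero_diagonal_imp_zero_row[OF psd] sym by blast
    then have "S $ Some i $ Some i = 0" for i using SV[of i] \<open>k = 0\<close> by simp
    with row have "S $ i $ j = 0" for i j
      using form_zero_diagonal_imp_zero_row[OF psd] sym by (metis not_None_eq)
    then show False using \<open>S \<noteq> 0\<close> by (simp add: vec_eq_iff)
  qed
  with \<open>0 \<le> k\<close> have k: "0 < k" by simp
  show ?thesis
  proof (rule that[of "(1 / k) *\<^sub>R S"])
    show "pos_semidef ((1 / k) *\<^sub>R S)"
      unfolding pos_semidef_def using psd sym k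
      by (simp add: scaleR_matrix_vector_assoc[symmetric] vec_eq_iff transpose_def)
    show "((1 / k) *\<^sub>R S) $ None $ None \<le> t" using S00 k by (simp add: field_simps)
    show "((1 / k) *\<^sub>R S) $ Some i $ Some i + 2 * ((1 / k) *\<^sub>R S) $ None $ Some i = - 1" for i
      using SV[of i] k by (simp add: field_simps)
  qed (simp add: nonedge)
qed

lemma theta_feasible_at_bound:
  fixes E :: "'n::finite set set"
  assumes simple: "simple_graph E" and t: "0 < t"
    and max: "\<And>X. theta'_feasible E X \<Longrightarrow> theta'_objective X \<le> t"
  shows "\<exists>Z. theta_feasible E t Z"
proof -
  obtain S where psd: "pos_semidef S" and S00: "S $ None $ None \<le> t"
    and nonedge: "\<And>i j. i \<noteq> j \<Longrightarrow> {i, j} \<notin> E \<Longrightarrow> S $ Some i $ Some j = 0"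
    and SV: "\<And>i. S $ Some i $ Some i + 2 * S $ None $ Some i = - 1"
    using theta'_separation[OF simple max] by metis
  note sym = pos_semidef_symmetric[OF psd]
  define u where "u i = - S $ None $ Some i" for i
  have S_diag: "S $ Some i $ Some i = 2 * u i - 1" for i using SV[of i] by (simp add: u_def)
  \<comment> \<open>The diagonal entry \<open>2 * u i - 1\<close> of \<open>S\<close> is
    nonnegative, so \<open>u i\<close> is at least \<open>1/2\<close>.\<close>
  have u: "0 < u i" for i
    using S_diag[of i] form_diagonal_nonneg[of S "Some i"] psd unfolding pos_semidef_def by simp
  define W :: "real^'n^'n" where
    "W = (\<chi> i j. if i = j then 1 else S $ Some i $ Some j / (u i * u j))"
  define Z :: "real^'n^'n" where "Z = (\<chi> i j. t * W$i$j - 1)"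
  have "pos_semidef Z"
  proof (rule pos_semidefI)
    show "Z$i$j = Z$j$i" for i j using sym[of "Some i" "Some j"] by (simp add: Z_def W_def mult.commute)
    fix x :: "'n \<Rightarrow> real"
    define q where "q = (\<Sum>i\<in>UNIV. \<Sum>j\<in>UNIV. W$i$j * x i * x j)"
    define r where "r = (\<Sum>i\<in>UNIV. x i)"
    have entry: "S $ Some i $ Some j * (x i / u i) * (x j / u j) \<le> W$i$j * x i * x j" for i j
    proof (cases "i = j")
      case True
      have "(2 * u i - 1) / (u i * u i) \<le> 1"
        using u[of i] zero_le_power2[of "u i - 1"] by (simp add: power2_eq_square algebra_simps)
      then have "(2 * u i - 1) / (u i * u i) * (x i * x i) \<le> 1 * (x i * x i)"
        by (intro mult_right_mono) auto
      then show ?thesis using True by (simp add: W_def S_diag)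
    qed (simp add: W_def)
    \<comment> \<open>Once the corner is bounded by \<open>t\<close>, the part of the form involving
      the coordinate \<open>c\<close> at \<open>None\<close> is
      \<open>t * c * c - 2 * c * r\<close>, which is least at \<open>c = r / t\<close>, with value
      \<open>- r * r / t\<close>.\<close>
    have "0 \<le> S $ None $ None * (r / t)\<^sup>2 + 2 * (r / t) * (\<Sum>i\<in>UNIV. S $ None $ Some i * (x i / u i))
        + (\<Sum>i\<in>UNIV. \<Sum>j\<in>UNIV. S $ Some i $ Some j * (x i / u i) * (x j / u j))"
      using pos_semidefD[OF psd, of "case_option (r / t) (\<lambda>i. x i / u i)"]
      unfolding quadratic_form_option[where M = S, OF sym] by simp
    also have "(\<Sum>i\<in>UNIV. S $ None $ Some i * (x i / u i)) = - r"
      unfolding r_def sum_negf[symmetric] using u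
      by (intro sum.cong refl) (simp add: u_def less_le)
    also have "S $ None $ None * (r / t)\<^sup>2 \<le> t * (r / t)\<^sup>2"
      using S00 by (rule mult_right_mono) simp
    also have "(\<Sum>i\<in>UNIV. \<Sum>j\<in>UNIV. S $ Some i $ Some j * (x i / u i) * (x j / u j)) \<le> q"
      unfolding q_def by (intro sum_mono entry)
    finally have "0 \<le> t * (r / t)\<^sup>2 + 2 * (r / t) * - r + q" by simp
    then have "0 \<le> t * (t * (r / t)\<^sup>2 + 2 * (r / t) * - r + q)" using t by simp
    also have "\<dots> = t * q - r\<^sup>2" using t by (simp add: power2_eq_square field_simps)
    also have "\<dots> = (\<Sum>i\<in>UNIV. \<Sum>j\<in>UNIV. Z$i$j * x i * x j)"
      unfolding q_def r_def power2_eq_square sum_product sum_distrib_left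
      by (simp add: Z_def left_diff_distrib right_diff_distrib sum_subtractf sum_distrib_left mult_ac)
    finally show "0 \<le> \<dots>" .
  qed
  then have "theta_feasible E t Z"
    unfolding theta_feasible_def by (simp add: Z_def W_def nonedge)
  then show ?thesis ..
qed

theorem theorem1:
  fixes E :: "'n::finite set set"
  assumes "simple_graph E"
  shows "is_maximum {theta'_objective Y |Y. theta'_feasible E Y} (theta' E) \<and>
         is_minimum {t. \<exists>Z. theta_feasible E t Z} (lovasz_theta E) \<and>
         theta' E = lovasz_theta E"
proof -
  obtain Y where Y: "theta'_feasible E Y" "1 \<le> theta'_objective Y"
    and max: "\<And>X. theta'_feasible E X \<Longrightarrow> theta'_objective X \<le> theta'_objective Y"
    using theta'_attained[OF assms] by blast
  let ?t = "theta'_objective Y"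
  \<comment> \<open>The primal maximum is itself a feasible dual value, its positivity coming from
    \<open>1 \<le> ?t\<close>; weak duality makes it the least one.\<close>
  obtain Z where Z: "theta_feasible E ?t Z"
    using theta_feasible_at_bound[OF assms _ max] Y(2) by force
  have "theta' E = ?t" unfolding theta'_def
    by (rule cSup_eq_maximum) (use Y max in auto)
  moreover have "lovasz_theta E = ?t" unfolding lovasz_theta_def
    by (rule cInf_eq_minimum) (use Z theta'_objective_le[OF Y(1)] in auto)
  ultimately show ?thesis
    unfolding is_maximum_def is_minimum_def
    using Y Z max theta'_objective_le[OF Y(1)] by auto
qed

end
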